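(* Let $C$ be a nonempty closed convex subset of a uniformly convex Banach space $X$, and let $T:C\to C$ be a mapping satisfying condition $(C)$ such that $F(T)\neq\emptyset$. For arbitrarily chosen $x_0\in C$, let the sequence $\{x_n\}$ be generated by $$z_n=(1-\beta_n)x_n+\beta_nTx_n,\qquad y_n=T\big((1-\alpha_n)Tx_n+\alpha_nTz_n\big),\qquad x_{n+1}=Ty_n\qquad(n\ge 0),$$ where $\{\alpha_n\}$ and $\{\beta_n\}$ are sequences of real numbers in $[a,b]$ for some $a,b$ with $0<a\le b<1$. If $T$ satisfies condition $(I)$, then $\{x_n\}$ converges strongly (in norm) to a fixed point of $T$.
   Context: $F(T)$ denotes the set of fixed points of $T$. A mapping $T:C\to C$ satisfies condition $(C)$ (is Suzuki generalized nonexpansive) if for all $x,y\in C$, $\frac12\|x-Tx\|\le\|x-y\|$ implies $\|Tx-Ty\|\le\|x-y\|$. A mapping $T:C\to C$ satisfies condition $(I)$ if there exists a nondecreasing function $f:[0,\infty)\to[0,\infty)$ with $f(0)=0$ and $f(r)>0$ for all $r>0$ such that $\|x-Tx\|\ge f(d(x,F(T)))$ for all $x\in C$, where $d(x,F(T))=\inf_{p\in F(T)}\|x-p\|$. Uniform convexity of a Banach space is understood in the standard sense. *)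

theory Defs
  imports "HOL-Analysis.Analysis"
begin

definition uniformly_convex :: "'a::real_normed_vector itself \<Rightarrow> bool" where
  "uniformly_convex _ \<longleftrightarrow>
     (\<forall>\<epsilon>. 0 < \<epsilon> \<and> \<epsilon> \<le> 2 \<longrightarrow>
       (\<exists>\<delta>>0. \<forall>x y :: 'a. norm x \<le> 1 \<and> norm y \<le> 1 \<and> norm (x - y) \<ge> \<epsilon> \<longrightarrow>
          norm ((1/2) *\<^sub>R (x + y)) \<le> 1 - \<delta>))"

text \<open>Mappings \<open>T : C \<rightarrow> C\<close> are total functions with \<open>T \<in> C \<rightarrow> C\<close>; values outside \<open>C\<close> are
  irrelevant, so fixed points are taken in \<open>C\<close> only.\<close>

definition fixed_points :: "'a set \<Rightarrow> ('a \<Rightarrow> 'a) \<Rightarrow> 'a set" where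
  "fixed_points C T = {p \<in> C. T p = p}"

definition condition_C :: "'a::real_normed_vector set \<Rightarrow> ('a \<Rightarrow> 'a) \<Rightarrow> bool" where
  "condition_C C T \<longleftrightarrow>
     (\<forall>x\<in>C. \<forall>y\<in>C. (1/2) * norm (x - T x) \<le> norm (x - y) \<longrightarrow>
        norm (T x - T y) \<le> norm (x - y))"

text \<open>For a nonempty fixed point set, \<open>infdist x (fixed_points C T)\<close> is the infimum of
  \<open>norm (x - p)\<close> over the fixed points \<open>p\<close>; on the empty set \<open>infdist\<close> is \<open>0\<close> by convention.\<close>

definition condition_I :: "'a::real_normed_vector set \<Rightarrow> ('a \<Rightarrow> 'a) \<Rightarrow> bool" where
  "condition_I C T \<longleftrightarrow>
     (\<exists>f :: real \<Rightarrow> real. f \<in> {0..} \<rightarrow> {0..} \<and> mono_on {0..} f \<and> f 0 = 0 \<and> (\<forall>r>0. f r > 0) \<and>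
        (\<forall>x\<in>C. norm (x - T x) \<ge> f (infdist x (fixed_points C T))))"

end

theory Submission
  imports Defs
begin

text \<open>
  The idea is that every fixed point \<open>p\<close> acts as a centre to which the iterates never move further
  away, and that they move strictly closer as long as \<open>x n\<close> is not almost fixed.

  Taking \<open>x = p\<close> in condition (C) makes its premise trivial, so \<open>T\<close> is quasi-nonexpansive:
  \<open>norm (T u - p) \<le> norm (u - p)\<close> for every \<open>u \<in> C\<close>.
  Following one round of the scheme with \<open>\<alpha> n \<ge> a\<close> gives
  \<open>norm (x (n + 1) - p) \<le> norm (x n - p) - a * (norm (x n - p) - norm (z n - p))\<close>.
  As \<open>z n\<close> is a convex combination of \<open>x n\<close> and \<open>T (x n)\<close>, both in the ball of radius
  \<open>norm (x n - p)\<close> about \<open>p\<close>, with weights bounded away from 0, uniform convexity makes the bracket at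
  least some \<open>\<eta> > 0\<close> independent of \<open>n\<close> whenever \<open>norm (x n - T (x n)) \<ge> \<epsilon>\<close>
  (\<open>uniformly_convex_combination_deficit\<close>).  Nonnegative distances cannot drop by \<open>a * \<eta>\<close> forever,
  so the residual \<open>norm (x n - T (x n))\<close> gets arbitrarily small
  (\<open>residual_arbitrarily_small\<close>).

  Condition (I) converts this into smallness of the distance from \<open>x n\<close> to the fixed point set.
  Since the sequence is Fejer monotone with respect to that set, being close to some fixed point once
  means staying close to it forever, so the sequence is Cauchy
  (\<open>Fejer_monotone_convergent\<close>).  Its limit lies at distance 0 from the fixed point set and
  therefore is a fixed point, again by quasi-nonexpansiveness.
\<close>

text \<open>
  Rescaling to the unit ball turns the separation \<open>\<epsilon>\<close> into \<open>\<epsilon> / r\<close>, which only an upper bound \<open>R\<close> on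
  the radius keeps away from 0.  Scaling back multiplies the deficit by \<open>r\<close>, and \<open>r \<ge> \<epsilon> / 2\<close> because
  the ball contains two points at distance \<open>\<epsilon>\<close> or more.
  A combination with weight \<open>t \<le> 1/2\<close> on \<open>v\<close> is itself a combination of \<open>u\<close> and the midpoint, with
  weight \<open>2 * t\<close> on the midpoint, so it inherits a share of the midpoint's deficit; the case
  \<open>t \<ge> 1/2\<close> is symmetric.
\<close>

lemma uniformly_convex_combination_deficit:
  fixes a b \<epsilon> R :: real
  assumes uc: "uniformly_convex TYPE('a::real_normed_vector)"
    and "0 < a" "b < 1" "0 < \<epsilon>"
  obtains \<eta> where "0 < \<eta>"
    and "\<And>(u::'a) v r t. norm u \<le> r \<Longrightarrow> norm v \<le> r \<Longrightarrow> r \<le> R \<Longrightarrow> \<epsilon> \<le> norm (u - v)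
           \<Longrightarrow> t \<in> {a..b} \<Longrightarrow> norm ((1 - t) *\<^sub>R u + t *\<^sub>R v) \<le> r - \<eta>"
proof (cases "0 < R \<and> \<epsilon> \<le> 2 * R")
  case False
  \<comment> \<open>No two points of a ball of radius \<open>R\<close> are then at distance \<open>\<epsilon>\<close> or more.\<close>
  have "\<not> \<epsilon> \<le> norm (u - v)" if "norm u \<le> r" "norm v \<le> r" "r \<le> R" for u v :: 'a and r
  proof
    assume "\<epsilon> \<le> norm (u - v)"
    then have "\<epsilon> \<le> 2 * R" using norm_triangle_ineq4[of u v] that by linarith
    with False \<open>0 < \<epsilon>\<close> show False by auto
  qed
  then show ?thesis using that[of 1] by (metis zero_less_one)
next
  case True
  then have "0 < R" and "0 < \<epsilon> / R \<and> \<epsilon> / R \<le> 2"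
    using \<open>0 < \<epsilon>\<close> by (auto simp: field_simps)
  then obtain \<delta> where "\<delta> > 0" and \<delta>: "\<And>x y :: 'a. norm x \<le> 1 \<Longrightarrow> norm y \<le> 1
      \<Longrightarrow> \<epsilon> / R \<le> norm (x - y) \<Longrightarrow> norm ((1/2) *\<^sub>R (x + y)) \<le> 1 - \<delta>"
    using uc[unfolded uniformly_convex_def, rule_format, of "\<epsilon> / R"] by metis
  define s where "s = min a (1 - b)"
  have "s > 0" using assms by (simp add: s_def)
  show ?thesis
  proof (rule that[of "s * \<epsilon> * \<delta>"])
    show "0 < s * \<epsilon> * \<delta>" using \<open>s > 0\<close> \<open>0 < \<epsilon>\<close> \<open>\<delta> > 0\<close> by simp
    fix u v :: 'a and r t
    assume u: "norm u \<le> r" and v: "norm v \<le> r" and "r \<le> R" and uv: "\<epsilon> \<le> norm (u - v)"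
      and t: "t \<in> {a..b}"
    have r2: "\<epsilon> \<le> 2 * r" using norm_triangle_ineq4[of u v] u v uv by linarith
    with \<open>0 < \<epsilon>\<close> have "r > 0" by simp
    have mid: "norm ((1/2) *\<^sub>R (u + v)) \<le> r - r * \<delta>"
    proof -
      have "\<epsilon> / R \<le> \<epsilon> / r"
        using \<open>r > 0\<close> \<open>r \<le> R\<close> \<open>0 < \<epsilon>\<close> by (simp add: frac_le)
      also have "\<dots> \<le> norm ((1/r) *\<^sub>R u - (1/r) *\<^sub>R v)"
        using uv \<open>r > 0\<close> by (simp add: divide_right_mono flip: scaleR_diff_right)
      finally have "norm ((1/2) *\<^sub>R ((1/r) *\<^sub>R u + (1/r) *\<^sub>R v)) \<le> 1 - \<delta>"
        using u v \<open>r > 0\<close> by (intro \<delta>) auto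
      moreover have "(1/2) *\<^sub>R ((1/r) *\<^sub>R u + (1/r) *\<^sub>R v) = (1/r) *\<^sub>R ((1/2) *\<^sub>R (u + v))"
        by (simp add: scaleR_add_right mult.commute)
      ultimately have "norm ((1/2) *\<^sub>R (u + v)) / r \<le> 1 - \<delta>"
        using \<open>r > 0\<close> by simp
      then show ?thesis using \<open>r > 0\<close> by (simp add: field_simps)
    qed
    have slide: "norm ((1 - t') *\<^sub>R w + t' *\<^sub>R w') \<le> r - s * \<epsilon> * \<delta>"
      if "norm w \<le> r" and m: "norm ((1/2) *\<^sub>R (w + w')) \<le> r - r * \<delta>" and "s \<le> t'" "t' \<le> 1/2"
      for w w' :: 'a and t'
    proof -
      have "(1 - t') *\<^sub>R w + t' *\<^sub>R w' = (1 - 2 * t') *\<^sub>R w + (2 * t') *\<^sub>R ((1/2) *\<^sub>R (w + w'))"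
        by (simp add: algebra_simps flip: scaleR_add_left)
      then have "norm ((1 - t') *\<^sub>R w + t' *\<^sub>R w')
          \<le> norm ((1 - 2 * t') *\<^sub>R w) + norm ((2 * t') *\<^sub>R ((1/2) *\<^sub>R (w + w')))"
        using norm_triangle_ineq by metis
      also have "\<dots> = (1 - 2 * t') * norm w + (2 * t') * norm ((1/2) *\<^sub>R (w + w'))"
        using that \<open>s > 0\<close> by simp
      also have "\<dots> \<le> (1 - 2 * t') * r + (2 * t') * (r - r * \<delta>)"
        using that \<open>s > 0\<close> by (intro add_mono mult_left_mono) auto
      also have "\<dots> = r - t' * (2 * r) * \<delta>" by (simp add: algebra_simps)
      also have "\<dots> \<le> r - s * \<epsilon> * \<delta>"
        using that \<open>s > 0\<close> \<open>0 < \<epsilon>\<close> \<open>\<delta> > 0\<close> r2 by (auto intro!: mult_mono)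
      finally show ?thesis .
    qed
    show "norm ((1 - t) *\<^sub>R u + t *\<^sub>R v) \<le> r - s * \<epsilon> * \<delta>"
    proof (cases "t \<le> 1/2")
      case True
      with t show ?thesis using slide[OF u mid, of t] by (auto simp: s_def)
    next
      case False
      with t show ?thesis
        using slide[OF v, of u "1 - t"] mid by (auto simp: s_def add.commute)
    qed
  qed
qed

text \<open>
  A sequence whose distance to each point of \<open>F\<close> never increases stays in every ball about a point of
  \<open>F\<close> that it has entered; entering arbitrarily small ones makes it Cauchy.
\<close>

lemma Fejer_monotone_convergent:
  fixes x :: "nat \<Rightarrow> 'a::complete_space"
  assumes "F \<noteq> {}"
    and mono: "\<And>p n. p \<in> F \<Longrightarrow> dist (x (Suc n)) p \<le> dist (x n) p"
    and small: "\<And>r. r > 0 \<Longrightarrow> \<exists>n. infdist (x n) F < r"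
  obtains q where "x \<longlonglongrightarrow> q" "infdist q F = 0"
proof -
  have enter: "\<exists>p\<in>F. \<exists>N. \<forall>n\<ge>N. dist (x n) p < r" if "r > 0" for r
  proof -
    from small[OF that] obtain N where "infdist (x N) F < r" by blast
    then have "(INF p\<in>F. dist (x N) p) < r" using \<open>F \<noteq> {}\<close> by (simp add: infdist_notempty)
    then obtain p where "p \<in> F" and p: "dist (x N) p < r"
      using \<open>F \<noteq> {}\<close> by (auto simp: cINF_less_iff)
    have "dist (x n) p \<le> dist (x N) p" if "n \<ge> N" for n
      using lift_Suc_antimono_le[of "\<lambda>n. dist (x n) p"] mono \<open>p \<in> F\<close> that by blast
    with p \<open>p \<in> F\<close> show ?thesis by (meson order_le_less_trans)
  qed
  have "Cauchy x"
  proof (rule metric_CauchyI)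
    fix e :: real assume "e > 0"
    then obtain p N where "\<forall>n\<ge>N. dist (x n) p < e / 2" using enter[of "e/2"] by auto
    then show "\<exists>M. \<forall>m\<ge>M. \<forall>n\<ge>M. dist (x m) (x n) < e" using dist_triangle_half_l by blast
  qed
  then obtain q where q: "x \<longlonglongrightarrow> q" by (auto simp: Cauchy_convergent_iff convergent_def)
  have "infdist q F \<le> 0 + r" if "r > 0" for r
  proof -
    from enter[OF that] obtain p N where "p \<in> F" and "\<forall>n\<ge>N. dist (x n) p < r" by auto
    then have "dist q p \<le> r"
      by (intro LIMSEQ_le_const2[OF tendsto_dist[OF q tendsto_const]]) (auto intro: less_imp_le)
    then show ?thesis using infdist_le[OF \<open>p \<in> F\<close>, of q] by simp
  qed
  then have "infdist q F \<le> 0" by (rule field_le_epsilon)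
  then show ?thesis using that[OF q] infdist_nonneg[of q F] by simp
qed

lemma condition_C_imp_quasi_nonexpansive:
  assumes "condition_C C T" "p \<in> fixed_points C T" "u \<in> C"
  shows "norm (T u - p) \<le> norm (u - p)"
proof -
  have "p \<in> C" "T p = p" using assms by (auto simp: fixed_points_def)
  then have "norm (T p - T u) \<le> norm (p - u)"
    using assms unfolding condition_C_def by fastforce
  then show ?thesis by (simp add: \<open>T p = p\<close> norm_minus_commute)
qed

text \<open>
  The fixed point set of a quasi-nonexpansive map is closed relative to \<open>C\<close>: both \<open>q\<close> and \<open>T q\<close> are
  within \<open>norm (q - p)\<close> of each fixed point \<open>p\<close>, and \<open>p\<close> can be chosen arbitrarily close to \<open>q\<close>.
\<close>

lemma fixed_point_if_infdist_0:
  assumes "condition_C C T" "fixed_points C T \<noteq> {}" "q \<in> C" "infdist q (fixed_points C T) = 0"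
  shows "q \<in> fixed_points C T"
proof -
  have "q \<in> closure (fixed_points C T)" using assms by (simp add: in_closure_iff_infdist_zero)
  then have near: "\<exists>p \<in> fixed_points C T. dist p q < e" if "e > 0" for e
    using that by (simp add: closure_approachable)
  have "norm (T q - q) \<le> 0 + e" if "e > 0" for e
  proof -
    from near[of "e / 2"] that obtain p where p: "p \<in> fixed_points C T" "dist p q < e / 2" by auto
    have "norm (T q - q) \<le> norm (T q - p) + norm (q - p)"
      using norm_triangle_ineq4[of "T q - p" "q - p"] by simp
    also have "\<dots> \<le> 2 * norm (q - p)"
      using condition_C_imp_quasi_nonexpansive[OF assms(1) p(1) \<open>q \<in> C\<close>] by simp
    also have "\<dots> \<le> e" using p(2) by (simp add: dist_norm norm_minus_commute)
    finally show ?thesis by simp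
  qed
  then have "norm (T q - q) \<le> 0" by (rule field_le_epsilon)
  then show ?thesis using \<open>q \<in> C\<close> by (simp add: fixed_points_def)
qed

text \<open>
  If the residual \<open>norm (x n - T (x n))\<close> never fell below \<open>\<epsilon>\<close>, each passage from \<open>x n\<close> to \<open>z n\<close> would gain
  a fixed amount \<open>\<eta>\<close>, of which the proportion \<open>a\<close> survives in \<open>x (Suc n)\<close>.
\<close>

lemma residual_arbitrarily_small:
  fixes x z :: "nat \<Rightarrow> 'a::real_normed_vector"
  assumes uc: "uniformly_convex TYPE('a)"
    and "0 < a" "b < 1" "0 < \<epsilon>"
    and \<beta>: "\<And>n. \<beta> n \<in> {a..b}"
    and z: "\<And>n. z n = (1 - \<beta> n) *\<^sub>R x n + \<beta> n *\<^sub>R T (x n)"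
    and quasi: "\<And>n. norm (T (x n) - p) \<le> norm (x n - p)"
    and gain: "\<And>n. norm (x (Suc n) - p) \<le> norm (x n - p) - a * (norm (x n - p) - norm (z n - p))"
    and mono: "\<And>n. norm (x (Suc n) - p) \<le> norm (x n - p)"
  shows "\<exists>n. norm (x n - T (x n)) < \<epsilon>"
proof (rule ccontr)
  assume "\<not> ?thesis"
  then have far: "\<epsilon> \<le> norm (x n - T (x n))" for n by (simp add: not_less)
  obtain \<eta> where "0 < \<eta>" and \<eta>: "\<And>(u::'a) v r t. norm u \<le> r \<Longrightarrow> norm v \<le> r
      \<Longrightarrow> r \<le> norm (x 0 - p) \<Longrightarrow> \<epsilon> \<le> norm (u - v) \<Longrightarrow> t \<in> {a..b}
      \<Longrightarrow> norm ((1 - t) *\<^sub>R u + t *\<^sub>R v) \<le> r - \<eta>"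
    using uniformly_convex_combination_deficit[OF uc \<open>0 < a\<close> \<open>b < 1\<close> \<open>0 < \<epsilon>\<close>] by metis
  have step: "norm (x (Suc n) - p) \<le> norm (x n - p) - a * \<eta>" for n
  proof -
    have "norm (x n - p) \<le> norm (x 0 - p)"
      using lift_Suc_antimono_le[of "\<lambda>n. norm (x n - p)" 0 n] mono by simp
    then have "norm ((1 - \<beta> n) *\<^sub>R (x n - p) + \<beta> n *\<^sub>R (T (x n) - p)) \<le> norm (x n - p) - \<eta>"
      using quasi far \<beta> by (intro \<eta>) auto
    moreover have "(1 - \<beta> n) *\<^sub>R (x n - p) + \<beta> n *\<^sub>R (T (x n) - p) = z n - p"
      by (simp add: z algebra_simps)
    ultimately have "a * \<eta> \<le> a * (norm (x n - p) - norm (z n - p))"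
      using \<open>0 < a\<close> by simp
    with gain[of n] show ?thesis by linarith
  qed
  have drop: "norm (x n - p) \<le> norm (x 0 - p) - real n * (a * \<eta>)" for n
  proof (induction n)
    case (Suc n)
    with step[of n] show ?case by (simp add: algebra_simps)
  qed simp
  obtain n where "norm (x 0 - p) < real n * (a * \<eta>)"
    using reals_Archimedean3[of "a * \<eta>"] \<open>0 < a\<close> \<open>0 < \<eta>\<close> by auto
  with drop[of n] norm_ge_zero[of "x n - p"] show False by linarith
qed

theorem theorem4p5:
  fixes C :: "'a::banach set"
    and T :: "'a \<Rightarrow> 'a"
    and x y z :: "nat \<Rightarrow> 'a"
    and \<alpha> \<beta> :: "nat \<Rightarrow> real"
    and a b :: real
  assumes "uniformly_convex TYPE('a)"
    and "C \<noteq> {}" and "closed C" and "convex C"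
    and "T \<in> C \<rightarrow> C"
    and "condition_C C T"
    and "fixed_points C T \<noteq> {}"
    and "0 < a" and "a \<le> b" and "b < 1"
    and "\<And>n. \<alpha> n \<in> {a..b}" and "\<And>n. \<beta> n \<in> {a..b}"
    and "x 0 \<in> C"
    and "\<And>n. z n = (1 - \<beta> n) *\<^sub>R x n + \<beta> n *\<^sub>R T (x n)"
    and "\<And>n. y n = T ((1 - \<alpha> n) *\<^sub>R T (x n) + \<alpha> n *\<^sub>R T (z n))"
    and "\<And>n. x (Suc n) = T (y n)"
    and "condition_I C T"
  shows "\<exists>p \<in> fixed_points C T. x \<longlonglongrightarrow> p"
proof -
  let ?F = "fixed_points C T"
  note \<alpha> = assms(11) and \<beta> = assms(12) and z = assms(14) and y = assms(15) and x = assms(16)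
  have TC: "T u \<in> C" if "u \<in> C" for u using \<open>T \<in> C \<rightarrow> C\<close> that by auto
  have bounds: "0 \<le> \<alpha> n" "\<alpha> n \<le> 1" "a \<le> \<alpha> n" "0 \<le> \<beta> n" "\<beta> n \<le> 1" for n
    using \<alpha>[of n] \<beta>[of n] \<open>0 < a\<close> \<open>b < 1\<close> by auto
  define w where "w n = (1 - \<alpha> n) *\<^sub>R T (x n) + \<alpha> n *\<^sub>R T (z n)" for n
  have zC: "z n \<in> C" and wC: "w n \<in> C" if "x n \<in> C" for n
  proof -
    show "z n \<in> C"
      unfolding z using bounds that TC by (intro convexD[OF \<open>convex C\<close>]) auto
    then show "w n \<in> C"
      unfolding w_def using bounds that TC by (intro convexD[OF \<open>convex C\<close>]) auto
  qed
  have xC: "x n \<in> C" for n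
    by (induction n) (auto simp: \<open>x 0 \<in> C\<close> x y TC wC simp flip: w_def)
  note quasi = condition_C_imp_quasi_nonexpansive[OF \<open>condition_C C T\<close>]
  have z_le: "norm (z n - p) \<le> norm (x n - p)" if p: "p \<in> ?F" for n p
  proof -
    have "z n - p = (1 - \<beta> n) *\<^sub>R (x n - p) + \<beta> n *\<^sub>R (T (x n) - p)"
      by (simp add: z algebra_simps)
    also have "norm \<dots> \<le> (1 - \<beta> n) * norm (x n - p) + \<beta> n * norm (T (x n) - p)"
      using bounds[of n] by (intro norm_triangle_le) simp
    also have "\<dots> \<le> norm (x n - p)"
      using bounds[of n] quasi[OF p xC] by (intro convex_bound_le) auto
    finally show ?thesis .
  qed
  have gain: "norm (x (Suc n) - p) \<le> norm (x n - p) - a * (norm (x n - p) - norm (z n - p))"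
    if p: "p \<in> ?F" for n p
  proof -
    have "norm (x (Suc n) - p) \<le> norm (w n - p)"
      using quasi[OF p wC[OF xC], of n] quasi[OF p TC[OF wC[OF xC]], of n]
      by (simp add: x y flip: w_def)
    also have "w n - p = (1 - \<alpha> n) *\<^sub>R (T (x n) - p) + \<alpha> n *\<^sub>R (T (z n) - p)"
      by (simp add: w_def algebra_simps)
    also have "norm \<dots> \<le> (1 - \<alpha> n) * norm (T (x n) - p) + \<alpha> n * norm (T (z n) - p)"
      using bounds[of n] by (intro norm_triangle_le) simp
    also have "\<dots> \<le> (1 - \<alpha> n) * norm (x n - p) + \<alpha> n * norm (z n - p)"
      using bounds[of n] quasi[OF p xC] quasi[OF p zC[OF xC]]
      by (intro add_mono mult_left_mono) auto
    also have "\<dots> = norm (x n - p) - \<alpha> n * (norm (x n - p) - norm (z n - p))"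
      by (simp add: algebra_simps)
    also have "\<dots> \<le> norm (x n - p) - a * (norm (x n - p) - norm (z n - p))"
      using bounds[of n] z_le[OF p, of n] by (intro diff_left_mono mult_right_mono) auto
    finally show ?thesis .
  qed
  have Fejer: "norm (x (Suc n) - p) \<le> norm (x n - p)" if p: "p \<in> ?F" for n p
  proof -
    have "0 \<le> a * (norm (x n - p) - norm (z n - p))"
      using \<open>0 < a\<close> z_le[OF p, of n] by simp
    with gain[OF p, of n] show ?thesis by linarith
  qed
  obtain p where p: "p \<in> ?F" using \<open>?F \<noteq> {}\<close> by auto
  obtain f :: "real \<Rightarrow> real" where f_mono: "mono_on {0..} f" and f_pos: "\<And>r. r > 0 \<Longrightarrow> f r > 0"
    and f_le: "\<And>u. u \<in> C \<Longrightarrow> f (infdist u ?F) \<le> norm (u - T u)"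
    using \<open>condition_I C T\<close> unfolding condition_I_def by auto
  have small: "\<exists>n. infdist (x n) ?F < r" if "r > 0" for r
  proof -
    \<comment> \<open>By monotonicity of \<open>f\<close>, a residual below \<open>f r\<close> forces the distance below \<open>r\<close>.\<close>
    have "\<exists>n. norm (x n - T (x n)) < f r"
      by (rule residual_arbitrarily_small[where \<beta> = \<beta> and z = z])
        (fact assms(1) \<open>0 < a\<close> \<open>b < 1\<close> f_pos[OF that] \<beta> z quasi[OF p xC] gain[OF p] Fejer[OF p])+
    then obtain n where "norm (x n - T (x n)) < f r" by blast
    then have "f (infdist (x n) ?F) < f r" using f_le[OF xC, of n] by linarith
    then have "infdist (x n) ?F < r"
      using mono_onD[OF f_mono, of r "infdist (x n) ?F"] that by fastforce
    then show ?thesis ..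
  qed
  obtain q where q: "x \<longlonglongrightarrow> q" "infdist q ?F = 0"
    using Fejer_monotone_convergent[of ?F x] \<open>?F \<noteq> {}\<close> Fejer small by (auto simp: dist_norm)
  have "q \<in> C" using closed_sequentially[OF \<open>closed C\<close> _ q(1)] xC by blast
  then have "q \<in> ?F" using fixed_point_if_infdist_0 assms(6,7) q(2) by blast
  with q(1) show ?thesis by blast
qed

end
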